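(* Let $A,B\in\mathbb{C}^{m\times n}$ with $\operatorname{rank}(A)=r\ge 1$ and $\operatorname{rank}(B)=s\ge 1$, and let $E=B-A$ and $\widetilde{E}=B^{\dagger}-A^{\dagger}$. Then \[ \|P_{B}-P_{A}\|_{F}^{2}+\min\bigg\{\frac{\|A^{\dagger}\|_{2}^{2}}{\|B^{\dagger}\|_{2}^{2}},\frac{\|B^{\dagger}\|_{2}^{2}}{\|A^{\dagger}\|_{2}^{2}}\bigg\}\|P_{B^{\ast}}-P_{A^{\ast}}\|_{F}^{2}\leq\big(\|A^{\dagger}\|_{2}^{2}+\|B^{\dagger}\|_{2}^{2}\big)\|E\|_{F}^{2}-\|B^{\dagger}\|_{2}^{2}\|A\widetilde{E}B\|_{F}^{2}-\|A^{\dagger}\|_{2}^{2}\|B\widetilde{E}A\|_{F}^{2}, \] \[ \|P_{B}-P_{A}\|_{F}^{2}+\|P_{B^{\ast}}-P_{A^{\ast}}\|_{F}^{2}\leq\max\big\{\|A^{\dagger}\|_{2}^{2},\|B^{\dagger}\|_{2}^{2}\big\}\big(2\|E\|_{F}^{2}-\|A\widetilde{E}B\|_{F}^{2}-\|B\widetilde{E}A\|_{F}^{2}\big). \] In particular, if $s=r$, then \[ \|P_{B}-P_{A}\|_{F}^{2}+\min\bigg\{\frac{\|A^{\dagger}\|_{2}^{2}}{\|B^{\dagger}\|_{2}^{2}},\frac{\|B^{\dagger}\|_{2}^{2}}{\|A^{\dagger}\|_{2}^{2}}\bigg\}\|P_{B^{\ast}}-P_{A^{\ast}}\|_{F}^{2}\leq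 2\min\big\{\|A^{\dagger}\|_{2}^{2}\|E\|_{F}^{2}-\|A^{\dagger}\|_{2}^{2}\|B\widetilde{E}A\|_{F}^{2},\ \|B^{\dagger}\|_{2}^{2}\|E\|_{F}^{2}-\|B^{\dagger}\|_{2}^{2}\|A\widetilde{E}B\|_{F}^{2}\big\}, \] \[ \|P_{B}-P_{A}\|_{F}^{2}+\|P_{B^{\ast}}-P_{A^{\ast}}\|_{F}^{2}\leq\frac{2\|A^{\dagger}\|_{2}^{2}\|B^{\dagger}\|_{2}^{2}}{\|A^{\dagger}\|_{2}^{2}+\|B^{\dagger}\|_{2}^{2}}\big(2\|E\|_{F}^{2}-\|A\widetilde{E}B\|_{F}^{2}-\|B\widetilde{E}A\|_{F}^{2}\big). \]
   Context: For a complex matrix $M$: $M^{\ast}$ is the conjugate transpose, $M^{\dagger}$ the Moore--Penrose inverse, $\|M\|_{F}$ the Frobenius norm, $\|M\|_{2}$ the spectral norm, and $P_{M}=MM^{\dagger}$ the orthogonal projection onto the column space of $M$ (so $P_{M^{\ast}}=M^{\dagger}M$). *)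

theory Defs
  imports "HOL-Analysis.Analysis"
begin

text \<open>An \<open>m \<times> n\<close> complex matrix is an element of type \<^typ>\<open>complex^'n^'m\<close> (rows indexed by \<open>'m\<close>).\<close>

definition conj_transpose :: "complex^'n^'m \<Rightarrow> complex^'m^'n" where
  "conj_transpose M = (\<chi> i j. cnj (M $ j $ i))"

definition is_moore_penrose :: "complex^'n^'m \<Rightarrow> complex^'m^'n \<Rightarrow> bool" where
  "is_moore_penrose M X \<longleftrightarrow>
     M ** X ** M = M \<and>
     X ** M ** X = X \<and>
     conj_transpose (M ** X) = M ** X \<and>
     conj_transpose (X ** M) = X ** M"

text \<open>By Penrose's theorem every complex matrix has exactly one such \<open>X\<close>,
  so the definite description below always denotes it.\<close>

definition pinv :: "complex^'n^'m \<Rightarrow> complex^'m^'n" where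
  "pinv M = (THE X. is_moore_penrose M X)"

definition col_proj :: "complex^'n^'m \<Rightarrow> complex^'m^'m" where
  "col_proj M = M ** pinv M"

definition frobenius_norm :: "complex^'n^'m \<Rightarrow> real" where
  "frobenius_norm M = sqrt (\<Sum>i\<in>UNIV. \<Sum>j\<in>UNIV. (cmod (M $ i $ j))\<^sup>2)"

text \<open>The norm on \<^typ>\<open>complex^'n\<close> is the Euclidean one, so the induced operator norm
  is the spectral norm.\<close>

definition spectral_norm :: "complex^'n^'m \<Rightarrow> real" where
  "spectral_norm M = onorm (\<lambda>x. M *v x)"

lemma frobenius_norm_eq_norm: "frobenius_norm M = norm M"
  by (simp add: frobenius_norm_def norm_vec_def L2_set_def sum_nonneg)

lemma is_moore_penrose_unique:
  assumes "is_moore_penrose M X" "is_moore_penrose M Y"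
  shows "X = Y"
proof -
  have ct: "conj_transpose (S ** T) = conj_transpose T ** conj_transpose S"
    for S :: "complex^'p^'q" and T :: "complex^'r^'p"
    by (simp add: conj_transpose_def matrix_matrix_mult_def vec_eq_iff mult.commute)
  note X = assms(1)[unfolded is_moore_penrose_def]
  note Y = assms(2)[unfolded is_moore_penrose_def]
  have "M ** X = (M ** Y) ** (M ** X)"
    using Y by (metis matrix_mul_assoc)
  then have "conj_transpose (M ** X) = (M ** X) ** (M ** Y)"
    using X Y ct by metis
  then have MX: "M ** X = M ** Y"
    using X by (metis matrix_mul_assoc)
  have "X ** M = (X ** M) ** (Y ** M)"
    using Y by (metis matrix_mul_assoc)
  then have "conj_transpose (X ** M) = (Y ** M) ** (X ** M)"
    using X Y ct by metis
  then have XM: "X ** M = Y ** M"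
    using X by (metis matrix_mul_assoc)
  show ?thesis
    using X Y MX XM by (metis matrix_mul_assoc)
qed

end

theory Submission
  imports Defs
begin

text \<open>Split \<open>E\<close> orthogonally by \<open>P_A\<close> on the left and \<open>P_{B*}\<close> on the right. The corner
  \<open>(I - P_A) E (I - P_{B*})\<close> vanishes, which gives
  \<open>||E||^2 = ||A Et B||^2 + ||(I - P_A) B||^2 + ||A (I - P_{B*})||^2\<close>.
  The last two terms control \<open>(I - P_A) P_B = (I - P_A) B pinv(B)\<close> and
  \<open>P_{A*} (I - P_{B*}) = pinv(A) A (I - P_{B*})\<close> through the spectral norms of the
  pseudoinverses. The same holds with \<open>A\<close> and \<open>B\<close> exchanged, and \<open>||P_B - P_A||^2\<close> is
  \<open>||(I - P_A) P_B||^2 + ||(I - P_B) P_A||^2\<close>. For equal ranks these two summands agree,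
  because \<open>P_A\<close> and \<open>P_B\<close> then have the same trace.\<close>

section \<open>Conjugate transposes\<close>

lemma conj_transpose_mul: "conj_transpose (S ** T) = conj_transpose T ** conj_transpose S"
  by (simp add: conj_transpose_def matrix_matrix_mult_def vec_eq_iff mult.commute)

lemma conj_transpose_conj_transpose [simp]: "conj_transpose (conj_transpose M) = M"
  by (simp add: conj_transpose_def vec_eq_iff)

lemma conj_transpose_diff: "conj_transpose (S - T) = conj_transpose S - conj_transpose T"
  by (simp add: conj_transpose_def vec_eq_iff)

text \<open>\<open>inner\<close> on complex vectors is the real part of the Hermitian product, and
  conjugate transposition is still the adjoint for it.\<close>

lemma inner_conj_transpose_mult_vec:
  fixes M :: "complex^'n^'m"
  shows "inner (M *v x) y = inner x (conj_transpose M *v y)"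
proof -
  have "inner (M *v x) y = (\<Sum>i\<in>UNIV. \<Sum>j\<in>UNIV. inner (M$i$j * x$j) (y$i))"
    by (simp add: inner_vec_def matrix_vector_mult_def inner_sum_left)
  also have "\<dots> = (\<Sum>j\<in>UNIV. \<Sum>i\<in>UNIV. inner (M$i$j * x$j) (y$i))"
    by (rule sum.swap)
  also have "\<dots> = (\<Sum>j\<in>UNIV. \<Sum>i\<in>UNIV. inner (x$j) (cnj (M$i$j) * y$i))"
    by (simp add: inner_complex_def algebra_simps)
  also have "\<dots> = inner x (conj_transpose M *v y)"
    by (simp add: inner_vec_def matrix_vector_mult_def inner_sum_right conj_transpose_def)
  finally show ?thesis .
qed

text \<open>Turns orthogonality and norms of matrices into matrix algebra: \<open>inner\<close> is
  the real part of the Hilbert-Schmidt product.\<close>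

lemma inner_eq_trace:
  fixes S T :: "complex^'n^'m"
  shows "inner S T = Re (trace (conj_transpose S ** T))"
proof -
  have "inner S T = (\<Sum>i\<in>UNIV. \<Sum>j\<in>UNIV. Re (cnj (S$i$j) * T$i$j))"
    by (simp add: inner_vec_def inner_complex_def)
  also have "\<dots> = (\<Sum>j\<in>UNIV. \<Sum>i\<in>UNIV. Re (cnj (S$i$j) * T$i$j))"
    by (rule sum.swap)
  also have "\<dots> = Re (trace (conj_transpose S ** T))"
    by (simp add: trace_def matrix_matrix_mult_def conj_transpose_def)
  finally show ?thesis .
qed

lemma norm_conj_transpose [simp]: "norm (conj_transpose M) = norm M"
  for M :: "complex^'n^'m"
proof -
  have "inner (conj_transpose M) (conj_transpose M) = inner M M"
    unfolding inner_eq_trace conj_transpose_conj_transpose by (metis trace_mul_sym)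
  then show ?thesis unfolding norm_eq_sqrt_inner by simp
qed

lemma matrix_mul_diff_left: "(S - T) ** U = S ** U - T ** U"
  for S T :: "'a::ring_1^'n^'m" and U :: "'a^'p^'n"
  by (simp add: matrix_matrix_mult_def vec_eq_iff left_diff_distrib sum_subtractf)

lemma matrix_mul_diff_right: "U ** (S - T) = U ** S - U ** T"
  for S T :: "'a::ring_1^'n^'m" and U :: "'a^'m^'p"
  by (simp add: matrix_matrix_mult_def vec_eq_iff right_diff_distrib sum_subtractf)

lemma conj_transpose_mult_self_eq_0:
  fixes Y :: "complex^'n^'m"
  assumes "conj_transpose Y ** Y = 0"
  shows "Y = 0"
  using assms inner_eq_trace[of Y Y] by (simp add: trace_def)

section \<open>Existence of the Moore--Penrose inverse\<close>

text \<open>A linear right inverse of \<open>M\<close> on its range sends each \<open>M *v x\<close>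
  to some preimage of it; \<open>G\<close> is its matrix.\<close>

lemma ex_generalized_inverse:
  fixes M :: "'a::field^'n^'m"
  obtains G :: "'a^'m^'n" where "M ** G ** M = M"
proof -
  obtain g where g: "Vector_Spaces.linear (*s) (*s) g" "\<forall>v\<in>range ((*v) M). M *v g v = v"
    using vec.linear_exists_right_inverse_on[OF matrix_vector_mul_linear_gen[of M] vec.subspace_UNIV]
    by blast
  have "M ** matrix g ** M = M"
    unfolding matrix_eq
    by (simp add: matrix_vector_mul_assoc [symmetric] matrix_works[OF g(1)] g(2))
  then show ?thesis by (rule that)
qed

text \<open>Whatever generalized inverse \<open>G\<close> of the Gram matrix is chosen,
  \<open>M ** G ** conj_transpose M\<close> is the orthogonal projection onto the column space of
  \<open>M\<close>.\<close>

lemma hermitian_gram_inverse: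
  fixes M :: "complex^'n^'m"
  assumes G: "conj_transpose M ** M ** G ** (conj_transpose M ** M) = conj_transpose M ** M"
  shows "M ** G ** conj_transpose M ** M = M"
    and "conj_transpose (M ** G ** conj_transpose M) = M ** G ** conj_transpose M"
proof -
  let ?N = "conj_transpose M"
  let ?P = "M ** G ** ?N"
  have "?N ** (?P ** M - M) = 0"
    using G by (simp add: matrix_mul_diff_right matrix_mul_assoc)
  \<comment> \<open>Both terms of the left factor end in \<open>?N\<close>, which annihilates
    \<open>?P ** M - M\<close>.\<close>
  then have "conj_transpose (?P ** M - M) ** (?P ** M - M) = 0"
    by (simp add: conj_transpose_diff conj_transpose_mul matrix_mul_diff_left
        flip: matrix_mul_assoc)
  then have "?P ** M - M = 0"
    by (rule conj_transpose_mult_self_eq_0)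
  then show PM: "?P ** M = M" by simp
  have ct: "conj_transpose ?P = M ** conj_transpose G ** ?N"
    by (simp add: conj_transpose_mul matrix_mul_assoc)
  \<comment> \<open>\<open>conj_transpose ?P\<close> starts with \<open>M\<close>, which
    \<open>?P\<close> fixes. The product on the left is Hermitian, hence so is
    \<open>?P\<close>.\<close>
  have "?P ** conj_transpose ?P = conj_transpose ?P"
    unfolding ct by (metis PM matrix_mul_assoc)
  then show "conj_transpose ?P = ?P"
    by (metis conj_transpose_mul conj_transpose_conj_transpose)
qed

text \<open>Urquhart's formula builds the Moore--Penrose inverse from arbitrary generalized inverses
  of the two Gram matrices.\<close>

lemma ex_moore_penrose: "\<exists>X. is_moore_penrose M X"
proof -
  let ?N = "conj_transpose M"
  obtain G where "?N ** M ** G ** (?N ** M) = ?N ** M"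
    by (rule ex_generalized_inverse)
  note G = hermitian_gram_inverse[OF this]
  obtain H where "M ** ?N ** H ** (M ** ?N) = M ** ?N"
    by (rule ex_generalized_inverse)
  note H = hermitian_gram_inverse[of ?N, simplified, OF this]
  have H': "M ** (?N ** H ** M) = M"
    using arg_cong[OF H(1), of conj_transpose] H(2)
    by (simp add: conj_transpose_mul)
  let ?X = "?N ** H ** M ** G ** ?N"
  have MX: "M ** ?X = M ** G ** ?N"
    using H' by (metis matrix_mul_assoc)
  have XM: "?X ** M = ?N ** H ** M"
    using G(1) by (metis matrix_mul_assoc)
  have "?X ** M ** ?X = ?X"
    unfolding XM using H(1) by (metis matrix_mul_assoc)
  then have "is_moore_penrose M ?X"
    unfolding is_moore_penrose_def MX XM using G H by simp
  then show ?thesis by blast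
qed

lemma is_moore_penrose_pinv: "is_moore_penrose M (pinv M)"
  unfolding pinv_def using ex_moore_penrose is_moore_penrose_unique
  by (metis the_equality)

lemma pinv_mult:
  "M ** pinv M ** M = M" "pinv M ** M ** pinv M = pinv M"
  "conj_transpose (M ** pinv M) = M ** pinv M" "conj_transpose (pinv M ** M) = pinv M ** M"
  using is_moore_penrose_pinv[of M] by (simp_all add: is_moore_penrose_def)

lemma pinv_nonzero: "M \<noteq> 0 \<Longrightarrow> pinv M \<noteq> 0"
  using pinv_mult(1)[of M] by force

text \<open>Conjugate transposition permutes the four Penrose equations, so uniqueness
  applies.\<close>

lemma pinv_conj_transpose: "pinv (conj_transpose M) = conj_transpose (pinv M)"
proof (rule is_moore_penrose_unique[OF is_moore_penrose_pinv])
  show "is_moore_penrose (conj_transpose M) (conj_transpose (pinv M))"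
    unfolding is_moore_penrose_def conj_transpose_mul [symmetric] matrix_mul_assoc [symmetric]
    by (simp add: pinv_mult matrix_mul_assoc)
qed

lemma col_proj_conj_transpose: "col_proj (conj_transpose M) = pinv M ** M"
  unfolding col_proj_def pinv_conj_transpose conj_transpose_mul [symmetric] pinv_mult(4) ..

section \<open>Frobenius and spectral norms\<close>

lemma norm_mult_vec_le_spectral_norm: "norm (M *v x) \<le> spectral_norm M * norm x"
  unfolding spectral_norm_def by (rule onorm) simp

lemma spectral_norm_nonneg: "0 \<le> spectral_norm M"
  unfolding spectral_norm_def by (rule onorm_pos_le) simp

text \<open>For \<open>z = conj_transpose M *v y\<close>, adjointness and Cauchy-Schwarz bound the
  square of \<open>norm z\<close> by \<open>spectral_norm M * norm z * norm y\<close>; one factor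
  \<open>norm z\<close> cancels.\<close>

lemma spectral_norm_conj_transpose_le: "spectral_norm (conj_transpose M) \<le> spectral_norm M"
  unfolding spectral_norm_def[of "conj_transpose M"]
proof (rule onorm_le)
  fix y
  let ?z = "conj_transpose M *v y"
  have "norm ?z * norm ?z = inner (M *v ?z) y"
    by (simp add: inner_conj_transpose_mult_vec flip: power2_eq_square power2_norm_eq_inner)
  also have "\<dots> \<le> norm (M *v ?z) * norm y" by (rule norm_cauchy_schwarz)
  also have "\<dots> \<le> (spectral_norm M * norm ?z) * norm y"
    by (intro mult_right_mono norm_mult_vec_le_spectral_norm norm_ge_zero)
  finally have "norm ?z * norm ?z \<le> (spectral_norm M * norm y) * norm ?z"
    by (simp add: algebra_simps)
  then show "norm ?z \<le> spectral_norm M * norm y"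
    by (cases "?z = 0") (simp_all add: spectral_norm_nonneg)
qed

lemma spectral_norm_pos:
  assumes "M \<noteq> 0"
  shows "0 < spectral_norm M"
proof (rule ccontr)
  assume "\<not> 0 < spectral_norm M"
  then have "spectral_norm M = 0" using spectral_norm_nonneg[of M] by simp
  then have "M *v x = 0" for x
    using norm_mult_vec_le_spectral_norm[of M x] by simp
  then show False using assms by (simp add: matrix_eq)
qed

lemma norm_power2_eq_sum_columns:
  fixes M :: "complex^'n^'m"
  shows "(norm M)\<^sup>2 = (\<Sum>j\<in>UNIV. (norm (column j M))\<^sup>2)"
proof -
  have "(norm M)\<^sup>2 = (\<Sum>i\<in>UNIV. \<Sum>j\<in>UNIV. (cmod (M$i$j))\<^sup>2)"
    by (simp add: norm_vec_def L2_set_def sum_nonneg)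
  also have "\<dots> = (\<Sum>j\<in>UNIV. \<Sum>i\<in>UNIV. (cmod (M$i$j))\<^sup>2)"
    by (rule sum.swap)
  also have "\<dots> = (\<Sum>j\<in>UNIV. (norm (column j M))\<^sup>2)"
    by (simp add: norm_vec_def L2_set_def sum_nonneg column_def)
  finally show ?thesis .
qed

text \<open>Left multiplication acts on each column separately, and the squared Frobenius norm is
  the sum over the columns.\<close>

lemma norm_mult_le_spectral_left:
  fixes S :: "complex^'n^'m" and T :: "complex^'p^'n"
  shows "norm (S ** T) \<le> spectral_norm S * norm T"
proof (rule power2_le_imp_le)
  have col: "column j (S ** T) = S *v column j T" for j
    by (simp add: column_def matrix_matrix_mult_def matrix_vector_mult_def vec_eq_iff)
  have "(norm (S ** T))\<^sup>2 \<le> (\<Sum>j\<in>UNIV. (spectral_norm S * norm (column j T))\<^sup>2)"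
    unfolding norm_power2_eq_sum_columns[of "S ** T"] col
    by (intro sum_mono power_mono norm_mult_vec_le_spectral_norm norm_ge_zero)
  then show "(norm (S ** T))\<^sup>2 \<le> (spectral_norm S * norm T)\<^sup>2"
    by (simp add: power_mult_distrib norm_power2_eq_sum_columns[of T] sum_distrib_left)
qed (simp add: spectral_norm_nonneg)

lemma norm_mult_le_spectral_right:
  fixes S :: "complex^'n^'m" and T :: "complex^'p^'n"
  shows "norm (S ** T) \<le> spectral_norm T * norm S"
proof -
  have "norm (S ** T) = norm (conj_transpose T ** conj_transpose S)"
    by (metis conj_transpose_mul norm_conj_transpose)
  also have "\<dots> \<le> spectral_norm (conj_transpose T) * norm S"
    using norm_mult_le_spectral_left[of "conj_transpose T" "conj_transpose S"] by simp
  also have "\<dots> \<le> spectral_norm T * norm S"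
    by (intro mult_right_mono spectral_norm_conj_transpose_le norm_ge_zero)
  finally show ?thesis .
qed

section \<open>Orthogonal projections\<close>

definition orth_proj :: "complex^'n^'n \<Rightarrow> bool" where
  "orth_proj P \<longleftrightarrow> P ** P = P \<and> conj_transpose P = P"

lemma orth_proj_col_proj: "orth_proj (M ** pinv M)"
  by (simp add: orth_proj_def matrix_mul_assoc pinv_mult)

lemma orth_proj_row_proj: "orth_proj (pinv M ** M)"
  by (simp add: orth_proj_def matrix_mul_assoc pinv_mult)

text \<open>Pythagoras: \<open>P ** M\<close> and \<open>M - P ** M\<close> are orthogonal for the
  trace inner product.\<close>

lemma norm_power2_split_left:
  assumes "orth_proj P"
  shows "(norm M)\<^sup>2 = (norm (P ** M))\<^sup>2 + (norm (M - P ** M))\<^sup>2"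
proof -
  have "conj_transpose (P ** M) ** (M - P ** M) = 0"
    using assms unfolding orth_proj_def
    by (simp add: conj_transpose_mul matrix_mul_diff_right)
      (metis matrix_mul_assoc)
  then have "orthogonal (P ** M) (M - P ** M)"
    by (simp add: orthogonal_def inner_eq_trace trace_def)
  then show ?thesis using norm_add_Pythagorean by fastforce
qed

lemma norm_power2_split_right:
  assumes "orth_proj P"
  shows "(norm M)\<^sup>2 = (norm (M ** P))\<^sup>2 + (norm (M - M ** P))\<^sup>2"
proof -
  have 1: "P ** conj_transpose M = conj_transpose (M ** P)"
    using assms by (simp add: orth_proj_def conj_transpose_mul)
  show ?thesis
    using norm_power2_split_left[OF assms, of "conj_transpose M"]
    by (simp add: 1 flip: conj_transpose_diff)
qed

lemma norm_mult_orth_proj_commute: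
  assumes "orth_proj P" "orth_proj Q"
  shows "norm (P ** Q) = norm (Q ** P)"
proof -
  have "Q ** P = conj_transpose (P ** Q)"
    using assms by (simp add: orth_proj_def conj_transpose_mul)
  then show ?thesis by simp
qed

lemma norm_diff_orth_proj_commute:
  assumes "orth_proj P" "orth_proj Q"
  shows "norm (P - P ** Q) = norm (P - Q ** P)"
proof -
  have "P - Q ** P = conj_transpose (P - P ** Q)"
    using assms by (simp add: orth_proj_def conj_transpose_diff conj_transpose_mul)
  then show ?thesis by simp
qed

text \<open>Splitting \<open>Q - P\<close> by \<open>P\<close> leaves \<open>P ** Q - P\<close> and
  \<open>Q - P ** Q\<close>; taking adjoints turns the first into \<open>Q ** P - P\<close> without
  changing its norm.\<close>

lemma norm_power2_diff_orth_proj: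
  assumes P: "orth_proj P" and Q: "orth_proj Q"
  shows "(norm (Q - P))\<^sup>2 = (norm (Q - P ** Q))\<^sup>2 + (norm (P - Q ** P))\<^sup>2"
proof -
  have "P ** (Q - P) = P ** Q - P" "(Q - P) - P ** (Q - P) = Q - P ** Q"
    using P by (simp_all add: orth_proj_def matrix_mul_diff_right)
  then have "(norm (Q - P))\<^sup>2 = (norm (P ** Q - P))\<^sup>2 + (norm (Q - P ** Q))\<^sup>2"
    using norm_power2_split_left[OF P, of "Q - P"] by simp
  then show ?thesis
    using norm_diff_orth_proj_commute[OF P Q] by (simp add: norm_minus_commute)
qed

lemma norm_power2_orth_proj: "orth_proj P \<Longrightarrow> (norm P)\<^sup>2 = Re (trace P)"
  unfolding power2_norm_eq_inner inner_eq_trace by (simp add: orth_proj_def)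

text \<open>By Pythagoras the two sides are \<open>trace Q\<close> and \<open>trace P\<close>, each
  minus the squared norm of \<open>P ** Q\<close>, which equals that of
  \<open>Q ** P\<close>.\<close>

lemma norm_orth_proj_swap:
  assumes P: "orth_proj P" and Q: "orth_proj Q" and "trace P = trace Q"
  shows "(norm (Q - P ** Q))\<^sup>2 = (norm (P - Q ** P))\<^sup>2"
proof -
  have "(norm P)\<^sup>2 = (norm Q)\<^sup>2"
    using assms by (simp add: norm_power2_orth_proj)
  then show ?thesis
    using norm_power2_split_left[OF P, of Q] norm_power2_split_left[OF Q, of P]
    unfolding norm_mult_orth_proj_commute[OF P Q] by linarith
qed

section \<open>Rank and trace\<close>

text \<open>Since \<open>rank\<close> is the dimension of the row span, this lets its elements be
  written as \<open>transpose M *v y\<close>.\<close>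

lemma range_transpose_eq_span_rows:
  fixes M :: "'a::field^'n^'m"
  shows "range ((*v) (transpose M)) = vec.span (rows M)"
proof
  have "transpose M *v x \<in> vec.span (rows M)" for x
    unfolding matrix_mult_sum
    by (intro vec.span_sum vec.span_scale vec.span_base) (auto simp: rows_def column_transpose)
  then show "range ((*v) (transpose M)) \<subseteq> vec.span (rows M)" by blast
  have "row i M = transpose M *v axis i 1" for i
    by (simp add: vec_eq_iff row_def transpose_def matrix_vector_mult_def axis_def if_distrib
        cong: if_cong)
  then have "rows M \<subseteq> range ((*v) (transpose M))"
    by (auto simp: rows_def)
  moreover have "vec.subspace (range ((*v) (transpose M)))"
    by (intro vec.linear_subspace_image matrix_vector_mul_linear_gen vec.subspace_UNIV)
  ultimately show "vec.span (rows M) \<subseteq> range ((*v) (transpose M))"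
    by (rule vec.span_minimal)
qed

lemma trace_transpose: "trace (transpose M) = trace M"
  by (simp add: trace_def transpose_def)

text \<open>An isomorphism between the row spaces, composed with the two idempotents, gives matrices
  \<open>S\<close> and \<open>T\<close> such that the idempotents are \<open>S T\<close> and \<open>T S\<close>.\<close>

lemma trace_idempotent_eq_of_rank_eq:
  fixes A B :: "'a::field^'n^'m" and X Y :: "'a^'m^'n"
  assumes "rank A = rank B" and A: "A ** X ** A = A" and B: "B ** Y ** B = B"
  shows "trace (A ** X) = trace (B ** Y)"
proof -
  \<comment> \<open>Transposing makes these idempotents project onto the row spans of
    \<open>A\<close> and \<open>B\<close>, whose dimensions are the ranks; the traces do not
    change.\<close>
  define P Q where "P = transpose (X ** A)" and "Q = transpose (Y ** B)"
  let ?S = "vec.span (rows A)" and ?T = "vec.span (rows B)"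
  have P: "P *v x \<in> ?S" for x
    by (simp add: P_def matrix_transpose_mul flip: range_transpose_eq_span_rows
        matrix_vector_mul_assoc)
  have Q: "Q *v x \<in> ?T" for x
    by (simp add: Q_def matrix_transpose_mul flip: range_transpose_eq_span_rows
        matrix_vector_mul_assoc)
  have P_tr: "P ** transpose A = transpose A"
    unfolding P_def matrix_transpose_mul [symmetric] matrix_mul_assoc A ..
  have P_id: "P *v x = x" if x: "x \<in> ?S" for x
  proof -
    obtain y where "x = transpose A *v y"
      using x unfolding range_transpose_eq_span_rows [symmetric] by blast
    then show ?thesis by (simp only: matrix_vector_mul_assoc P_tr)
  qed
  have Q_tr: "Q ** transpose B = transpose B"
    unfolding Q_def matrix_transpose_mul [symmetric] matrix_mul_assoc B ..
  have Q_id: "Q *v x = x" if x: "x \<in> ?T" for x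
  proof -
    obtain y where "x = transpose B *v y"
      using x unfolding range_transpose_eq_span_rows [symmetric] by blast
    then show ?thesis by (simp only: matrix_vector_mul_assoc Q_tr)
  qed
  have "vec.dim ?S = vec.dim ?T"
    using assms(1) by (simp add: row_rank_def_gen)
  then obtain f where f: "Vector_Spaces.linear (*s) (*s) f" "f ` ?S = ?T" "inj_on f ?S"
    using vec.subspace_isomorphism[OF vec.subspace_span vec.subspace_span] by metis
  obtain g where g: "Vector_Spaces.linear (*s) (*s) g" "\<forall>v\<in>?S. g (f v) = v"
    using vec.linear_exists_left_inverse_on[OF f(1) vec.subspace_span f(3)] by blast
  have gT: "g y \<in> ?S" "f (g y) = y" if "y \<in> ?T" for y
    using that f(2) g(2) by force+
  define F G where "F = matrix f ** P" and "G = matrix g ** Q"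
  note app = matrix_vector_mul_assoc[symmetric] matrix_works[OF f(1)] matrix_works[OF g(1)]
  have "F ** G = Q"
    unfolding matrix_eq F_def G_def using Q gT P_id by (simp add: app)
  moreover have "G ** F = P"
    unfolding matrix_eq F_def G_def using P g(2) Q_id imageI[of _ ?S f, unfolded f(2)]
    by (simp add: app)
  ultimately have "trace P = trace Q"
    by (metis trace_mul_sym)
  then show ?thesis
    unfolding P_def Q_def trace_transpose by (metis trace_mul_sym)
qed

section \<open>The perturbation bounds\<close>

lemma norm_power2_diff_split:
  fixes A B :: "complex^'n^'m"
  shows "(norm (B - A))\<^sup>2 = (norm (A ** (pinv B - pinv A) ** B))\<^sup>2
    + (norm (B - A ** pinv A ** B))\<^sup>2 + (norm (A - A ** (pinv B ** B)))\<^sup>2"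
proof -
  let ?P = "A ** pinv A" and ?R = "pinv B ** B"
  \<comment> \<open>Both sides equal \<open>?P ** B - A ** ?R\<close>, because
    \<open>B ** ?R = B\<close> and \<open>?P ** A = A\<close>.\<close>
  have 1: "?P ** (B - A) ** ?R = - (A ** (pinv B - pinv A) ** B)"
    by (simp add: matrix_mul_diff_left matrix_mul_diff_right matrix_mul_assoc pinv_mult(1))
      (metis matrix_mul_assoc pinv_mult(1))
  have 2: "?P ** (B - A) - ?P ** (B - A) ** ?R = - (A - A ** ?R)"
    by (simp add: matrix_mul_diff_left matrix_mul_diff_right matrix_mul_assoc pinv_mult(1))
      (metis matrix_mul_assoc pinv_mult(1))
  \<comment> \<open>This is the vanishing corner: \<open>?R\<close> fixes \<open>B - ?P ** B\<close>
    from the right, so this part needs no further splitting.\<close>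
  have 3: "(B - A) - ?P ** (B - A) = B - ?P ** B"
    by (simp add: matrix_mul_diff_right pinv_mult(1))
  show ?thesis
    using norm_power2_split_left[OF orth_proj_col_proj, of "B - A" A]
      norm_power2_split_right[OF orth_proj_row_proj, of "?P ** (B - A)" B]
    unfolding 2 3 unfolding 1 norm_minus_cancel by linarith
qed

text \<open>The weight \<open>b / a\<close> gives both residuals of
  \<open>norm_power2_diff_split\<close> the same factor \<open>b\<close>, so that they add up. Using
  this for \<open>(A, B)\<close> and for \<open>(B, A)\<close> covers all four projection
  defects.\<close>

lemma projection_bound:
  fixes A B :: "complex^'n^'m"
  assumes "A \<noteq> 0"
  defines "a \<equiv> (spectral_norm (pinv A))\<^sup>2" and "b \<equiv> (spectral_norm (pinv B))\<^sup>2"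
  shows "(norm (B ** pinv B - A ** pinv A ** (B ** pinv B)))\<^sup>2
      + b / a * (norm (pinv A ** A - pinv B ** B ** (pinv A ** A)))\<^sup>2
    \<le> b * ((norm (B - A))\<^sup>2 - (norm (A ** (pinv B - pinv A) ** B))\<^sup>2)"
proof -
  have a: "a > 0"
    unfolding a_def by (intro zero_less_power spectral_norm_pos pinv_nonzero assms(1))
  have "B ** pinv B - A ** pinv A ** (B ** pinv B) = (B - A ** pinv A ** B) ** pinv B"
    by (simp add: matrix_mul_diff_left matrix_mul_assoc)
  then have 1: "(norm (B ** pinv B - A ** pinv A ** (B ** pinv B)))\<^sup>2
      \<le> b * (norm (B - A ** pinv A ** B))\<^sup>2"
    unfolding b_def
    by (metis norm_mult_le_spectral_right norm_ge_zero power_mono power_mult_distrib)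
  \<comment> \<open>Taking the adjoint moves the projection of \<open>B\<close> to the right, so
    that \<open>pinv A\<close> can be pulled out on the left.\<close>
  have "norm (pinv A ** A - pinv B ** B ** (pinv A ** A))
      = norm (pinv A ** (A - A ** (pinv B ** B)))"
    unfolding norm_diff_orth_proj_commute[OF orth_proj_row_proj orth_proj_row_proj, symmetric]
    by (simp add: matrix_mul_diff_right matrix_mul_assoc)
  then have "(norm (pinv A ** A - pinv B ** B ** (pinv A ** A)))\<^sup>2
      \<le> a * (norm (A - A ** (pinv B ** B)))\<^sup>2"
    unfolding a_def
    by (metis norm_mult_le_spectral_left norm_ge_zero power_mono power_mult_distrib)
  then have "b / a * (norm (pinv A ** A - pinv B ** B ** (pinv A ** A)))\<^sup>2
      \<le> b / a * (a * (norm (A - A ** (pinv B ** B)))\<^sup>2)"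
    by (rule mult_left_mono) (simp add: a_def b_def)
  also have "\<dots> = b * (norm (A - A ** (pinv B ** B)))\<^sup>2"
    using a by simp
  finally show ?thesis
    using 1 unfolding norm_power2_diff_split[of B A] by (simp add: algebra_simps)
qed

lemma rank_zero: "rank (0 :: 'a::field^'n^'m) = 0"
proof -
  have "rows (0 :: 'a^'n^'m) \<subseteq> {0}"
    by (auto simp: rows_def row_def vec_eq_iff)
  then show ?thesis by (simp add: row_rank_def_gen)
qed

theorem corollary3p3:
  fixes A B E :: "complex^'n^'m" and Et :: "complex^'m^'n" and r s :: nat
  assumes "rank A = r" and "r \<ge> 1"
    and "rank B = s" and "s \<ge> 1"
    and "E = B - A" and "Et = pinv B - pinv A"
  shows
    "((frobenius_norm (col_proj B - col_proj A))\<^sup>2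
       + min ((spectral_norm (pinv A))\<^sup>2 / (spectral_norm (pinv B))\<^sup>2)
             ((spectral_norm (pinv B))\<^sup>2 / (spectral_norm (pinv A))\<^sup>2)
         * (frobenius_norm (col_proj (conj_transpose B) - col_proj (conj_transpose A)))\<^sup>2
     \<le> ((spectral_norm (pinv A))\<^sup>2 + (spectral_norm (pinv B))\<^sup>2) * (frobenius_norm E)\<^sup>2
       - (spectral_norm (pinv B))\<^sup>2 * (frobenius_norm (A ** Et ** B))\<^sup>2
       - (spectral_norm (pinv A))\<^sup>2 * (frobenius_norm (B ** Et ** A))\<^sup>2)
     \<and>
    ((frobenius_norm (col_proj B - col_proj A))\<^sup>2
       + (frobenius_norm (col_proj (conj_transpose B) - col_proj (conj_transpose A)))\<^sup>2
     \<le> max ((spectral_norm (pinv A))\<^sup>2) ((spectral_norm (pinv B))\<^sup>2)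
       * (2 * (frobenius_norm E)\<^sup>2
          - (frobenius_norm (A ** Et ** B))\<^sup>2 - (frobenius_norm (B ** Et ** A))\<^sup>2))
     \<and>
    (s = r \<longrightarrow>
    ((frobenius_norm (col_proj B - col_proj A))\<^sup>2
       + min ((spectral_norm (pinv A))\<^sup>2 / (spectral_norm (pinv B))\<^sup>2)
             ((spectral_norm (pinv B))\<^sup>2 / (spectral_norm (pinv A))\<^sup>2)
         * (frobenius_norm (col_proj (conj_transpose B) - col_proj (conj_transpose A)))\<^sup>2
     \<le> 2 * min ((spectral_norm (pinv A))\<^sup>2 * (frobenius_norm E)\<^sup>2
                - (spectral_norm (pinv A))\<^sup>2 * (frobenius_norm (B ** Et ** A))\<^sup>2)
               ((spectral_norm (pinv B))\<^sup>2 * (frobenius_norm E)\<^sup>2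
                - (spectral_norm (pinv B))\<^sup>2 * (frobenius_norm (A ** Et ** B))\<^sup>2))
     \<and>
    ((frobenius_norm (col_proj B - col_proj A))\<^sup>2
       + (frobenius_norm (col_proj (conj_transpose B) - col_proj (conj_transpose A)))\<^sup>2
     \<le> 2 * (spectral_norm (pinv A))\<^sup>2 * (spectral_norm (pinv B))\<^sup>2
         / ((spectral_norm (pinv A))\<^sup>2 + (spectral_norm (pinv B))\<^sup>2)
       * (2 * (frobenius_norm E)\<^sup>2
          - (frobenius_norm (A ** Et ** B))\<^sup>2 - (frobenius_norm (B ** Et ** A))\<^sup>2)))"
proof -
  define a b where "a = (spectral_norm (pinv A))\<^sup>2" and "b = (spectral_norm (pinv B))\<^sup>2"
  define x y where "x = (norm E)\<^sup>2 - (norm (A ** Et ** B))\<^sup>2"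
    and "y = (norm E)\<^sup>2 - (norm (B ** Et ** A))\<^sup>2"
  let ?P = "A ** pinv A" and ?Q = "B ** pinv B" and ?R = "pinv A ** A" and ?S = "pinv B ** B"
  define p p' q q' where "p = (norm (?Q - ?P ** ?Q))\<^sup>2" and "p' = (norm (?P - ?Q ** ?P))\<^sup>2"
    and "q = (norm (?S - ?R ** ?S))\<^sup>2" and "q' = (norm (?R - ?S ** ?R))\<^sup>2"
  \<comment> \<open>Rank at least 1 makes \<open>a\<close> and \<open>b\<close> positive, so all
    quotients below are genuine.\<close>
  have nz: "A \<noteq> 0" "B \<noteq> 0"
    using assms rank_zero by (metis not_one_le_zero)+
  have pos: "a > 0" "b > 0"
    unfolding a_def b_def by (intro zero_less_power spectral_norm_pos pinv_nonzero nz)+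
  have nonneg: "0 \<le> p" "0 \<le> p'" "0 \<le> q" "0 \<le> q'"
    by (simp_all add: p_def p'_def q_def q'_def)
  have col: "(frobenius_norm (col_proj B - col_proj A))\<^sup>2 = p + p'"
    unfolding p_def p'_def frobenius_norm_eq_norm col_proj_def
    by (rule norm_power2_diff_orth_proj) (rule orth_proj_col_proj)+
  have row: "(frobenius_norm (col_proj (conj_transpose B) - col_proj (conj_transpose A)))\<^sup>2 = q + q'"
    unfolding q_def q'_def frobenius_norm_eq_norm col_proj_conj_transpose
    by (rule norm_power2_diff_orth_proj) (rule orth_proj_row_proj)+
  have X: "p + b / a * q' \<le> b * x"
    using projection_bound[OF nz(1), of B]
    by (simp add: a_def b_def p_def q'_def x_def assms(5,6))
  \<comment> \<open>Exchanging \<open>A\<close> and \<open>B\<close> only changes signs.\<close>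
  have E: "norm (A - B) = norm E" "norm (B ** (pinv A - pinv B) ** A) = norm (B ** Et ** A)"
    unfolding assms(5,6)
    by (simp_all add: norm_minus_commute matrix_mul_diff_left matrix_mul_diff_right)
  have Y: "p' + a / b * q \<le> a * y"
    using projection_bound[OF nz(2), of A]
    by (simp add: a_def b_def p'_def q_def y_def E)
  have X': "p / b + q' / a \<le> x" and Y': "p' / a + q / b \<le> y"
    using X Y pos by (simp_all add: field_simps)
  \<comment> \<open>Being below both quotients, \<open>c\<close> may replace either weight on either
    row defect.\<close>
  define c where "c = min (a / b) (b / a)"
  have c: "c * q' \<le> b / a * q'" "c * q \<le> a / b * q" "c * q \<le> b / a * q" "c * q' \<le> a / b * q'"
    using nonneg unfolding c_def by (intro mult_right_mono min.cobounded1 min.cobounded2; simp)+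
  have 1: "p + p' + c * (q + q') \<le> b * x + a * y"
    using X Y c by (simp add: distrib_left)
  have 2: "p + p' + (q + q') \<le> max a b * (x + y)"
  proof -
    let ?m = "max a b"
    \<comment> \<open>Write \<open>t = s * (t / s)\<close> and enlarge \<open>s\<close> to the
      maximum.\<close>
    have "t \<le> ?m * (t / s)" if "0 \<le> t" "0 < s" "s \<le> ?m" for s t
      using mult_right_mono[OF that(3,1)] that(2) by (simp add: field_simps)
    then have "p \<le> ?m * (p / b)" "q' \<le> ?m * (q' / a)" "p' \<le> ?m * (p' / a)" "q \<le> ?m * (q / b)"
      using nonneg pos by simp_all
    then have "p + p' + (q + q') \<le> ?m * ((p / b + q' / a) + (p' / a + q / b))"
      by (simp add: distrib_left)
    also have "\<dots> \<le> ?m * (x + y)"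
      using X' Y' pos by (intro mult_left_mono add_mono) auto
    finally show ?thesis .
  qed
  have 3: "p + p' + c * (q + q') \<le> 2 * min (a * y) (b * x)"
    and 4: "p + p' + (q + q') \<le> 2 * a * b / (a + b) * (x + y)" if "s = r"
  proof -
    have tr: "trace ?P = trace ?Q"
      using assms(1,3) that by (intro trace_idempotent_eq_of_rank_eq pinv_mult(1)) simp
    then have tr': "trace ?R = trace ?S"
      by (metis trace_mul_sym)
    have "p = p'"
      unfolding p_def p'_def by (intro norm_orth_proj_swap orth_proj_col_proj tr)
    moreover have "q = q'"
      unfolding q_def q'_def by (intro norm_orth_proj_swap orth_proj_row_proj tr')
    ultimately have eq: "p' = p" "q' = q" by simp_all
    \<comment> \<open>The left side is now \<open>2 * (p + c * q)\<close>, which \<open>X\<close>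
      and \<open>Y\<close> each bound on their own.\<close>
    show "p + p' + c * (q + q') \<le> 2 * min (a * y) (b * x)"
      using X Y c unfolding eq by (auto simp: min_def)
    \<comment> \<open>Adding \<open>X'\<close> and \<open>Y'\<close> gives
      \<open>(p + q) * (1 / a + 1 / b) \<le> x + y\<close>, whence the harmonic mean of
      \<open>a\<close> and \<open>b\<close>.\<close>
    have "(p + q) * (a + b) \<le> (a * b) * (x + y)"
    proof -
      have "(p + q) * (a + b) = (a * b) * ((p / b + q / a) + (p / a + q / b))"
        using pos by (simp add: field_simps)
      also have "\<dots> \<le> (a * b) * (x + y)"
        using X' Y' pos unfolding eq by (intro mult_left_mono add_mono) auto
      finally show ?thesis .
    qed
    then show "p + p' + (q + q') \<le> 2 * a * b / (a + b) * (x + y)"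
      using pos unfolding eq by (simp add: field_simps)
  qed
  have sum: "2 * (norm E)\<^sup>2 - (norm (A ** Et ** B))\<^sup>2 - (norm (B ** Et ** A))\<^sup>2 = x + y"
    by (simp add: x_def y_def)
  show ?thesis
    unfolding col row unfolding frobenius_norm_eq_norm a_def [symmetric] b_def [symmetric]
      c_def [symmetric] sum
    using 1 2 3 4 by (simp add: x_def y_def algebra_simps)
qed

end
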